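(* Let $N$ be a timelike ruled surface of type $N_-$ in $\mathbb{R}_1^3$ with timelike striction curve $\vec c$, curvatures $k_1,k_2$ and angle function $\theta$, and let $N^\beta$ be a $\beta$-transversal surface of $N$. Then the striction curve $\vec c_\beta$ of $N^\beta$ coincides with the striction curve $\vec c$ of $N$ if and only if $$\tanh\theta=\frac{k_1}{\beta'+k_2}$$ holds on $I$.
   Context: $\mathbb{R}_1^3$ is Minkowski 3-space with metric $\langle\cdot,\cdot\rangle=-dx_1^2+dx_2^2+dx_3^2$. A nonzero vector $\vec v$ is timelike if $\langle\vec v,\vec v\rangle<0$, null if $\langle\vec v,\vec v\rangle=0$, spacelike if $\langle\vec v,\vec v\rangle>0$. Setting. All functions are smooth on an open interval $I$. A timelike ruled surface of type $N_-$ with timelike striction curve is $\vec r(s,v)=\vec c(s)+v\vec q(s)$, with ruling direction $\vec q$ unit timelike, where $\vec c$ is its striction curve, a timelike curve parametrized by arc length $s$. It has a Frenet frame $\{\vec q,\vec h,\vec a\}$ of mutually orthogonal vectors, $\langle\vec q,\vec q\rangle=-1$, $\langle\vec h,\vec h\rangle=\langle\vec a,\vec a\rangle=1$ ($\vec h$ is the central normal, i.e. the surface normal along $\vec c$; $\vec a$ the central tangent), with $\vec q\,'=k_1\vec h$, $\vec h'=k_1\vec q+k_2\vec a$, $\vec a'=-k_2\vec h$ (prime is $d/ds$) for functions $k_1,k_2$. Standing assumption: the derivatives of the frame vectors are non-null and $N$ is non-cylindrical; in particular $k_1\neq0$ and $k_1^2\neq k_2^2$ everywhere. The unit tangent of $\vec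 c$ is $\vec c\,'=\vec t=\cosh\theta\,\vec q+\sinh\theta\,\vec a$ for a real function $\theta$ (the hyperbolic angle between $\vec t$ and $\vec q$). $\beta$-transversal surface. For a function $\beta:I\to\mathbb{R}$ with $\beta(s)\neq n\pi,\ (2n+1)\pi/2$ for all $s\in I$, $n\in\mathbb{Z}$, $N^\beta$ is the ruled surface $\vec r_\beta(s,v)=\vec c(s)+v\vec q_\beta(s)$ with $\vec q_\beta=\cos\beta\,\vec h+\sin\beta\,\vec a$; it is assumed that $\langle\vec q_\beta',\vec q_\beta'\rangle\ne0$ everywhere. Its striction curve is $\vec c_\beta=\vec c+v_\beta\vec q_\beta$ with $v_\beta=-\langle\vec c\,',\vec q_\beta'\rangle/\langle\vec q_\beta',\vec q_\beta'\rangle$; it coincides with $\vec c$ if $v_\beta=0$ on $I$. Convention: an equation containing a quotient is understood to include that its denominator is nonzero. *)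

theory Defs
  imports "HOL-Analysis.Analysis"
begin

definition mink :: "real ^ 3 \<Rightarrow> real ^ 3 \<Rightarrow> real" where
  "mink x y = - (x $ 1 * y $ 1) + x $ 2 * y $ 2 + x $ 3 * y $ 3"

text \<open>The zero vector has no causal character; in particular it is not null.\<close>

definition timelike :: "real ^ 3 \<Rightarrow> bool" where
  "timelike x \<longleftrightarrow> x \<noteq> 0 \<and> mink x x < 0"

definition null_vec :: "real ^ 3 \<Rightarrow> bool" where
  "null_vec x \<longleftrightarrow> x \<noteq> 0 \<and> mink x x = 0"

abbreviation vderiv :: "(real \<Rightarrow> 'a::real_normed_vector) \<Rightarrow> real \<Rightarrow> 'a" where
  "vderiv f \<equiv> (\<lambda>s. vector_derivative f (at s))"

text \<open>Smoothness is used on open sets only, so that two-sided derivatives are the right ones.\<close>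

definition smooth_on :: "real set \<Rightarrow> (real \<Rightarrow> 'a::real_normed_vector) \<Rightarrow> bool" where
  "smooth_on I f \<longleftrightarrow> (\<forall>n. \<forall>s\<in>I. (vderiv ^^ n) f differentiable (at s))"

text \<open>A ruled surface \<open>r(s,v) = c(s) + v q(s)\<close> is represented by its base curve \<open>c\<close> and
  its ruling direction \<open>q\<close>.\<close>

definition striction_param :: "(real \<Rightarrow> real ^ 3) \<Rightarrow> (real \<Rightarrow> real ^ 3) \<Rightarrow> real \<Rightarrow> real" where
  "striction_param c q s = - mink (vderiv c s) (vderiv q s) / mink (vderiv q s) (vderiv q s)"

definition striction_curve ::
    "(real \<Rightarrow> real ^ 3) \<Rightarrow> (real \<Rightarrow> real ^ 3) \<Rightarrow> real \<Rightarrow> real ^ 3" where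
  "striction_curve c q s = c s + striction_param c q s *\<^sub>R q s"

text \<open>The surface is automatically timelike where it is regular, its tangent planes containing
  the timelike vector \<open>q\<close>, and \<open>h\<close> is orthogonal to both \<open>c'\<close> and \<open>q\<close>, i.e. normal to the
  surface along \<open>c\<close>. Non-cylindrical means that \<open>q'\<close> vanishes nowhere.\<close>

locale timelike_ruled_surface_Nminus =
  fixes I :: "real set"
    and c q h a :: "real \<Rightarrow> real ^ 3"
    and k1 k2 \<theta> :: "real \<Rightarrow> real"
  assumes interval: "open I" "is_interval I" "I \<noteq> {}"
    and smooth_vec: "smooth_on I c" "smooth_on I q" "smooth_on I h" "smooth_on I a"
    and smooth_fun: "smooth_on I k1" "smooth_on I k2" "smooth_on I \<theta>"
    and striction: "\<And>s. s \<in> I \<Longrightarrow> striction_curve c q s = c s"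
    and timelike_curve: "\<And>s. s \<in> I \<Longrightarrow> timelike (vderiv c s)"
    and arc_length: "\<And>s. s \<in> I \<Longrightarrow> mink (vderiv c s) (vderiv c s) = -1"
    and frame_unit: "\<And>s. s \<in> I \<Longrightarrow> mink (q s) (q s) = -1"
      "\<And>s. s \<in> I \<Longrightarrow> mink (h s) (h s) = 1"
      "\<And>s. s \<in> I \<Longrightarrow> mink (a s) (a s) = 1"
    and frame_orth: "\<And>s. s \<in> I \<Longrightarrow> mink (q s) (h s) = 0"
      "\<And>s. s \<in> I \<Longrightarrow> mink (q s) (a s) = 0"
      "\<And>s. s \<in> I \<Longrightarrow> mink (h s) (a s) = 0"
    and frenet: "\<And>s. s \<in> I \<Longrightarrow> vderiv q s = k1 s *\<^sub>R h s"
      "\<And>s. s \<in> I \<Longrightarrow> vderiv h s = k1 s *\<^sub>R q s + k2 s *\<^sub>R a s"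
      "\<And>s. s \<in> I \<Longrightarrow> vderiv a s = - (k2 s *\<^sub>R h s)"
    and non_null: "\<And>s. s \<in> I \<Longrightarrow> \<not> null_vec (vderiv q s)"
      "\<And>s. s \<in> I \<Longrightarrow> \<not> null_vec (vderiv h s)"
      "\<And>s. s \<in> I \<Longrightarrow> \<not> null_vec (vderiv a s)"
    and non_cylindrical: "\<And>s. s \<in> I \<Longrightarrow> vderiv q s \<noteq> 0"
    and tangent: "\<And>s. s \<in> I \<Longrightarrow> vderiv c s = cosh (\<theta> s) *\<^sub>R q s + sinh (\<theta> s) *\<^sub>R a s"
begin

lemma k1_nonzero: "s \<in> I \<Longrightarrow> k1 s \<noteq> 0"
  using non_cylindrical frenet(1) by fastforce

lemma k1_sq_neq_k2_sq:
  assumes s: "s \<in> I"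
  shows "(k1 s)\<^sup>2 \<noteq> (k2 s)\<^sup>2"
proof
  assume eq: "(k1 s)\<^sup>2 = (k2 s)\<^sup>2"
  have lin: "mink (x *\<^sub>R u + y *\<^sub>R v) w = x * mink u w + y * mink v w" for x y u v w
    by (simp add: mink_def algebra_simps)
  have sym: "mink u v = mink v u" for u v
    by (simp add: mink_def)
  have hq: "mink (vderiv h s) (q s) = - k1 s"
    unfolding frenet(2)[OF s] lin sym[of "a s" "q s"]
    using frame_unit(1)[OF s] frame_orth(2)[OF s] by simp
  have ha: "mink (vderiv h s) (a s) = k2 s"
    unfolding frenet(2)[OF s] lin
    using frame_unit(3)[OF s] frame_orth(2)[OF s] by simp
  have "mink (vderiv h s) (vderiv h s)
      = k1 s * mink (q s) (vderiv h s) + k2 s * mink (a s) (vderiv h s)"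
    using frenet(2)[OF s] lin by metis
  also have "\<dots> = 0"
    using hq ha eq sym[of "q s" "vderiv h s"] sym[of "a s" "vderiv h s"]
    by (simp add: power2_eq_square)
  finally have "mink (vderiv h s) (vderiv h s) = 0" .
  moreover have "vderiv h s \<noteq> 0"
    using hq k1_nonzero[OF s] by (auto simp: mink_def)
  ultimately show False
    using non_null(2)[OF s] by (simp add: null_vec_def)
qed

end

definition transversal_dir ::
    "(real \<Rightarrow> real) \<Rightarrow> (real \<Rightarrow> real ^ 3) \<Rightarrow> (real \<Rightarrow> real ^ 3) \<Rightarrow> real \<Rightarrow> real ^ 3" where
  "transversal_dir \<beta> h a s = cos (\<beta> s) *\<^sub>R h s + sin (\<beta> s) *\<^sub>R a s"

text \<open>The \<open>\<beta>\<close>-transversal surface is the ruled surface with base curve \<open>c\<close> and ruling direction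
  \<^term>\<open>transversal_dir \<beta> h a\<close>; the following are the conditions imposed on \<open>\<beta>\<close>.\<close>

definition transversal_angle ::
    "real set \<Rightarrow> (real \<Rightarrow> real ^ 3) \<Rightarrow> (real \<Rightarrow> real ^ 3) \<Rightarrow> (real \<Rightarrow> real) \<Rightarrow> bool" where
  "transversal_angle I h a \<beta> \<longleftrightarrow>
     smooth_on I \<beta> \<and>
     (\<forall>s\<in>I. \<forall>n::int. \<beta> s \<noteq> of_int n * pi \<and> \<beta> s \<noteq> (2 * of_int n + 1) * pi / 2) \<and>
     (\<forall>s\<in>I. mink (vderiv (transversal_dir \<beta> h a) s) (vderiv (transversal_dir \<beta> h a) s) \<noteq> 0)"

end

theory Submission
  imports Defs
begin

text \<open>The equivalence holds at each point separately. The direction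
  \<open>transversal_dir \<beta> h a\<close> never vanishes, so the two striction curves agree at
  \<open>s\<close> exactly when c' is orthogonal to its derivative
  (\<open>striction_curve_eq_iff\<close>). The Frenet formulas expand that derivative in the frame
  (\<open>vderiv_transversal_dir\<close>), and the product with c' becomes cos \<beta> times sinh
  \<theta> (\<beta>' + k2) - cosh \<theta> k1 (\<open>mink_tangent_vderiv_transversal_dir\<close>).
  Since cos \<beta> is nonzero, the second factor must vanish; as k1 is nonzero, this is the
  quotient equation (\<open>tanh_eq_divide_iff\<close>).\<close>

lemma mink_frame_combination:
  assumes "mink q q = -1" "mink h h = 1" "mink a a = 1"
    and "mink q h = 0" "mink q a = 0" "mink h a = 0"
  shows "mink (x *\<^sub>R q + y *\<^sub>R h + z *\<^sub>R a) (x' *\<^sub>R q + y' *\<^sub>R h + z' *\<^sub>R a)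
    = - (x * x') + y * y' + z * z'"
proof -
  have "mink (x *\<^sub>R q + y *\<^sub>R h + z *\<^sub>R a) (x' *\<^sub>R q + y' *\<^sub>R h + z' *\<^sub>R a)
      = x * x' * mink q q + y * y' * mink h h + z * z' * mink a a
        + (x * y' + y * x') * mink q h + (x * z' + z * x') * mink q a
        + (y * z' + z * y') * mink h a"
    by (simp add: mink_def algebra_simps)
  with assms show ?thesis by simp
qed

lemma smooth_on_imp_differentiable:
  assumes "smooth_on I f" "s \<in> I"
  shows "f differentiable (at s)"
  using assms unfolding smooth_on_def by (metis funpow_0)

lemma has_vector_derivative_transversal_dir:
  assumes \<beta>: "(\<beta> has_real_derivative b) (at s)"
    and h: "(h has_vector_derivative h') (at s)"
    and a: "(a has_vector_derivative a') (at s)"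
  shows "(transversal_dir \<beta> h a has_vector_derivative
      cos (\<beta> s) *\<^sub>R h' - (sin (\<beta> s) * b) *\<^sub>R h s + sin (\<beta> s) *\<^sub>R a' + (cos (\<beta> s) * b) *\<^sub>R a s) (at s)"
proof -
  have "((\<lambda>t. cos (\<beta> t)) has_real_derivative - sin (\<beta> s) * b) (at s)"
    and "((\<lambda>t. sin (\<beta> t)) has_real_derivative cos (\<beta> s) * b) (at s)"
    by (auto intro!: derivative_eq_intros \<beta>)
  from has_vector_derivative_add[OF has_vector_derivative_scaleR[OF this(1) h]
      has_vector_derivative_scaleR[OF this(2) a]]
  show ?thesis
    unfolding transversal_dir_def by (simp add: algebra_simps)
qed

text \<open>The displacement is a multiple of the nonzero vector \<open>q s\<close>, so its
  coefficient must vanish. The denominator has to be nonzero: division by 0 yields 0 and would make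
  the curves agree for any numerator.\<close>

lemma striction_curve_eq_iff:
  assumes "q s \<noteq> 0" "mink (vderiv q s) (vderiv q s) \<noteq> 0"
  shows "striction_curve c q s = c s \<longleftrightarrow> mink (vderiv c s) (vderiv q s) = 0"
  using assms by (simp add: striction_curve_def striction_param_def)

text \<open>For \<open>d = 0\<close> the right side reads 0 = cosh t * k, which is impossible; so
  the product form already forces the denominator to be nonzero.\<close>

lemma tanh_eq_divide_iff:
  fixes t k d :: real
  assumes "k \<noteq> 0"
  shows "d \<noteq> 0 \<and> tanh t = k / d \<longleftrightarrow> sinh t * d = cosh t * k"
proof -
  have "cosh t \<noteq> 0" by simp
  with assms show ?thesis
    by (cases "d = 0") (simp_all add: tanh_def frac_eq_eq mult.commute)
qed

context timelike_ruled_surface_Nminus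
begin

text \<open>The direction is a unit spacelike vector, because h and a are orthonormal.\<close>

lemma transversal_dir_nonzero:
  assumes s: "s \<in> I"
  shows "transversal_dir \<beta> h a s \<noteq> 0"
proof
  assume 0: "transversal_dir \<beta> h a s = 0"
  have "mink (transversal_dir \<beta> h a s) (transversal_dir \<beta> h a s)
      = cos (\<beta> s) * cos (\<beta> s) + sin (\<beta> s) * sin (\<beta> s)"
    using mink_frame_combination[OF frame_unit[OF s] frame_orth[OF s],
        of 0 "cos (\<beta> s)" "sin (\<beta> s)" 0 "cos (\<beta> s)" "sin (\<beta> s)"]
    by (simp add: transversal_dir_def)
  also have "\<dots> = 1"
    by (simp flip: power2_eq_square)
  finally show False
    unfolding 0 by (simp add: mink_def)
qed

text \<open>The Frenet equations rotate h and a at rate k2 within their plane, which adds to the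
  rate \<beta>' of the angle; the q component comes from h' alone.\<close>

lemma vderiv_transversal_dir:
  assumes s: "s \<in> I" and "\<beta> differentiable (at s)"
  shows "vderiv (transversal_dir \<beta> h a) s = (k1 s * cos (\<beta> s)) *\<^sub>R q s
    + (- sin (\<beta> s) * (deriv \<beta> s + k2 s)) *\<^sub>R h s + (cos (\<beta> s) * (deriv \<beta> s + k2 s)) *\<^sub>R a s"
proof -
  have "(\<beta> has_real_derivative deriv \<beta> s) (at s)"
    using assms(2) by (simp add: DERIV_deriv_iff_real_differentiable)
  moreover have "(h has_vector_derivative k1 s *\<^sub>R q s + k2 s *\<^sub>R a s) (at s)"
    using smooth_on_imp_differentiable[OF smooth_vec(3) s] frenet(2)[OF s]
    by (metis vector_derivative_works)
  moreover have "(a has_vector_derivative - (k2 s *\<^sub>R h s)) (at s)"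
    using smooth_on_imp_differentiable[OF smooth_vec(4) s] frenet(3)[OF s]
    by (metis vector_derivative_works)
  ultimately show ?thesis
    by (subst vector_derivative_at[OF has_vector_derivative_transversal_dir])
      (assumption | simp add: algebra_simps)+
qed

text \<open>The tangent has no h component, so only the q and a components contribute, and both
  carry the factor cos \<beta>.\<close>

lemma mink_tangent_vderiv_transversal_dir:
  assumes s: "s \<in> I" and \<beta>: "\<beta> differentiable (at s)"
  shows "mink (vderiv c s) (vderiv (transversal_dir \<beta> h a) s)
    = cos (\<beta> s) * (sinh (\<theta> s) * (deriv \<beta> s + k2 s) - cosh (\<theta> s) * k1 s)"
  using mink_frame_combination[OF frame_unit[OF s] frame_orth[OF s],
      of "cosh (\<theta> s)" 0 "sinh (\<theta> s)"
      "k1 s * cos (\<beta> s)" "- sin (\<beta> s) * (deriv \<beta> s + k2 s)" "cos (\<beta> s) * (deriv \<beta> s + k2 s)"]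
  \<comment> \<open>The term with coefficient 0 is erased so that the instance matches the form of
    \<open>tangent\<close>.\<close>
  by (simp only: vderiv_transversal_dir[OF s \<beta>] tangent[OF s] scaleR_zero_left add_0_right)
    (simp add: right_diff_distrib)

end

theorem theorem5p1:
  fixes I :: "real set"
    and c q h a :: "real \<Rightarrow> real ^ 3"
    and k1 k2 \<theta> \<beta> :: "real \<Rightarrow> real"
  assumes "timelike_ruled_surface_Nminus I c q h a k1 k2 \<theta>"
    and "transversal_angle I h a \<beta>"
  shows "(\<forall>s\<in>I. striction_curve c (transversal_dir \<beta> h a) s = c s) \<longleftrightarrow>
         (\<forall>s\<in>I. deriv \<beta> s + k2 s \<noteq> 0 \<and> tanh (\<theta> s) = k1 s / (deriv \<beta> s + k2 s))"
proof (rule ball_cong[OF refl])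
  interpret timelike_ruled_surface_Nminus I c q h a k1 k2 \<theta> by fact
  fix s assume s: "s \<in> I"
  have \<beta>: "\<beta> differentiable (at s)"
    and spacing: "\<And>n::int. \<beta> s \<noteq> (2 * of_int n + 1) * pi / 2"
    and nonnull: "mink (vderiv (transversal_dir \<beta> h a) s) (vderiv (transversal_dir \<beta> h a) s) \<noteq> 0"
    using assms(2) s smooth_on_imp_differentiable unfolding transversal_angle_def by blast+
  \<comment> \<open>The zeros of cosine are the odd multiples of pi/2, which the angle
    avoids.\<close>
  have cos: "cos (\<beta> s) \<noteq> 0"
  proof
    assume "cos (\<beta> s) = 0"
    then obtain n :: int where "\<beta> s = n * pi + pi / 2"
      by (auto simp: cos_zero_iff_int2)
    with spacing[of n] show False by (simp add: field_simps)
  qed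
  have "striction_curve c (transversal_dir \<beta> h a) s = c s
      \<longleftrightarrow> mink (vderiv c s) (vderiv (transversal_dir \<beta> h a) s) = 0"
    by (rule striction_curve_eq_iff[OF transversal_dir_nonzero[OF s] nonnull])
  also have "\<dots> \<longleftrightarrow> sinh (\<theta> s) * (deriv \<beta> s + k2 s) = cosh (\<theta> s) * k1 s"
    using cos by (simp add: mink_tangent_vderiv_transversal_dir[OF s \<beta>])
  also have "\<dots> \<longleftrightarrow> deriv \<beta> s + k2 s \<noteq> 0 \<and> tanh (\<theta> s) = k1 s / (deriv \<beta> s + k2 s)"
    using tanh_eq_divide_iff[OF k1_nonzero[OF s]] by simp
  finally show "striction_curve c (transversal_dir \<beta> h a) s = c s \<longleftrightarrow>
      deriv \<beta> s + k2 s \<noteq> 0 \<and> tanh (\<theta> s) = k1 s / (deriv \<beta> s + k2 s)" .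
qed

end
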